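(* Let $m$ and $n$ be positive integers and let $\mathcal{P}_n$ be the set of partitions of $n$. For a partition $\lambda\in\mathcal{P}_n$ written as $n=t_1+2t_2+\cdots+nt_n$ (where $t_i$ is the multiplicity of the part $i$, with $t_i=0$ for $i>n$), define for $1\le k\le n$ \[ \alpha_{k,m}(\lambda)=t_{km},\qquad \alpha'_{k,m}(\lambda)=\lfloor t_k/m\rfloor, \] \[ \gamma_m(\lambda)=\sum_{\substack{i\ge 1\\ m\nmid i}} i\,t_i \ \ (\text{the sum of the parts of }\lambda\text{ not divisible by }m\text{, counted with multiplicity}),\qquad \gamma'_m(\lambda)=\sum_{i=1}^{n} i\,\langle t_i\rangle_m . \] Then, as polynomials in the variables $x_1,\dots,x_n,z$, \[ \sum_{\lambda\in\mathcal{P}_n}x_1^{\alpha_{1,m}(\lambda)}x_2^{\alpha_{2,m}(\lambda)}\cdots x_n^{\alpha_{n,m}(\lambda)}z^{\gamma_m(\lambda)} =\sum_{\lambda\in\mathcal{P}_n}x_1^{\alpha'_{1,m}(\lambda)}x_2^{\alpha'_{2,m}(\lambda)}\cdots x_n^{\alpha'_{n,m}(\lambda)}z^{\gamma'_m(\lambda)}. \]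
   Context: $\lfloor x\rfloor$ denotes the integer part of $x$; for an integer $x$, $\langle x\rangle_m$ denotes the least non-negative integer $r$ with $x\equiv r\pmod m$. *)

theory Defs
  imports "HOL-Library.Multiset" "HOL-Library.Poly_Mapping"
begin

text \<open>A partition is the multiset of its parts, so the multiplicity $t_i$ is
  \<open>count p i\<close>; in particular $t_i = 0$ for $i > n$ holds automatically.\<close>

definition partitions :: "nat \<Rightarrow> nat multiset set" where
  "partitions n = {p. 0 \<notin># p \<and> \<Sum>\<^sub># p = n}"

text \<open>The sum over \<^term>\<open>partitions n\<close> ranges over a finite set, so it is not
  the default value \<open>0\<close>.\<close>

lemma finite_partitions: "finite (partitions n)"
proof (rule finite_subset)
  show "partitions n \<subseteq> mset ` {xs. set xs \<subseteq> {1..n} \<and> length xs \<le> n}"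
  proof
    fix p assume "p \<in> partitions n"
    then have p: "0 \<notin># p" "\<Sum>\<^sub># p = n"
      by (auto simp: partitions_def)
    obtain xs where xs: "p = mset xs"
      by (metis ex_mset)
    have pos: "0 \<notin> set xs" and sum: "sum_list xs = n"
      using p xs by (auto simp: sum_mset_sum_list)
    have "1 \<le> x \<and> x \<le> n" if "x \<in> set xs" for x
      using pos sum that member_le_sum_list[of x xs] by (cases x) auto
    then have "set xs \<subseteq> {1..n}"
      by auto
    moreover have "length xs \<le> sum_list xs"
      using pos by (induction xs) (auto simp: Suc_le_eq)
    ultimately show "p \<in> mset ` {xs. set xs \<subseteq> {1..n} \<and> length xs \<le> n}"
      using sum xs by auto
  qed
  show "finite (mset ` {xs. set xs \<subseteq> {1..n} \<and> length xs \<le> n})"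
    by (intro finite_imageI finite_lists_length_le) simp
qed

definition alpha :: "nat \<Rightarrow> nat \<Rightarrow> nat multiset \<Rightarrow> nat" where
  "alpha k m p = count p (k * m)"

definition alpha' :: "nat \<Rightarrow> nat \<Rightarrow> nat multiset \<Rightarrow> nat" where
  "alpha' k m p = count p k div m"

definition gamma :: "nat \<Rightarrow> nat multiset \<Rightarrow> nat" where
  "gamma m p = (\<Sum>i | i \<in># p \<and> \<not> m dvd i. i * count p i)"

definition gamma' :: "nat \<Rightarrow> nat \<Rightarrow> nat multiset \<Rightarrow> nat" where
  "gamma' n m p = (\<Sum>i=1..n. i * (count p i mod m))"

text \<open>Integer polynomials in indeterminates $x_1, x_2, \dots$ and $z$: finitely supported
  maps from monomials (finitely supported exponent vectors) to coefficients, with the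
  convolution product of \<^theory>\<open>HOL-Library.Poly_Mapping\<close>.\<close>

datatype indet = X nat | Z

type_synonym polynomial = "(indet \<Rightarrow>\<^sub>0 nat) \<Rightarrow>\<^sub>0 int"

definition var :: "indet \<Rightarrow> polynomial" where
  "var v = Poly_Mapping.single (Poly_Mapping.single v 1) 1"

end

theory Submission
  imports Defs
begin

text \<open>Both sides split a partition \<open>p\<close> of \<open>n\<close> uniquely into an arbitrary partition \<open>q\<close>,
  weighted by \<open>m\<close>, and a remainder \<open>r\<close>. On the left \<open>q\<close> consists of the parts divisible by \<open>m\<close>,
  divided by \<open>m\<close>, and \<open>r\<close> has no part divisible by \<open>m\<close>; on the right \<open>q\<close> collects the blocks of
  \<open>m\<close> equal parts, and every multiplicity in \<open>r\<close> is less than \<open>m\<close>. In both cases the monomial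
  is determined by \<open>q\<close> and the size of \<open>r\<close>, so it suffices that both kinds of remainder
  of size \<open>N\<close> are equinumerous (Glaisher). No explicit bijection is needed: counting all
  partitions of \<open>N\<close> by either decomposition gives the same recurrence for the number of
  remainders.\<close>

text \<open>Elements of \<open>A\<close> outside \<open>p\<close> contribute zero, so
  \<open>A\<close> may be the support (for \<open>gamma\<close>) or all of \<open>{1..n}\<close>
  (for \<open>gamma'\<close>).\<close>

lemma sum_mset_eq_sum_count:
  fixes p :: "nat multiset"
  assumes "finite A" "set_mset p \<subseteq> A"
  shows "\<Sum>\<^sub># p = (\<Sum>i\<in>A. i * count p i)"
  using assms(2)
proof (induction p)
  case (add x p)
  have "(\<Sum>i\<in>A. i * count (add_mset x p) i) =
      (\<Sum>i\<in>A. i * count p i) + (\<Sum>i\<in>A. if i = x then x else 0)"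
    unfolding sum.distrib [symmetric] by (rule sum.cong) auto
  with add assms(1) show ?case
    by simp
qed simp

lemma sum_mset_image_mult: "\<Sum>\<^sub># (image_mset ((*) m) q) = m * \<Sum>\<^sub># q" for m :: nat
  by (induction q) (auto simp: algebra_simps)

lemma sum_mset_repeat_mset: "\<Sum>\<^sub># (repeat_mset m q) = m * \<Sum>\<^sub># q" for m :: nat
  by (induction m) (auto simp: algebra_simps)

text \<open>Treats both decompositions at once: \<open>c\<close> reassembles \<open>q\<close> and
  \<open>r\<close>, and \<open>R\<close> singles out the admissible remainders. By
  \<open>weight\<close>, the size \<open>j\<close> of \<open>q\<close> fixes the size of
  \<open>r\<close>, so the pairs can be sorted by \<open>j\<close>.\<close>

lemma sum_partitions_decompose:
  fixes F :: "nat multiset \<Rightarrow> 'a :: comm_monoid_add"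
  assumes "m > 0"
    and bij: "bij_betw (\<lambda>(q, r). c q r) ({q. 0 \<notin># q} \<times> {r. 0 \<notin># r \<and> R r}) {p. 0 \<notin># p}"
    and weight: "\<And>q r. \<Sum>\<^sub># (c q r) = m * \<Sum>\<^sub># q + \<Sum>\<^sub># r"
  shows "(\<Sum>p\<in>partitions n. F p) =
    (\<Sum>j\<le>n div m. \<Sum>q\<in>partitions j. \<Sum>r | r \<in> partitions (n - m * j) \<and> R r. F (c q r))"
proof -
  let ?D = "{q :: nat multiset. 0 \<notin># q} \<times> {r. 0 \<notin># r \<and> R r}"
  let ?S = "SIGMA j:{..n div m}. SIGMA q:partitions j. {r. r \<in> partitions (n - m * j) \<and> R r}"
  have le: "m * j \<le> n" if "j \<le> n div m" for j
    using that \<open>m > 0\<close> by (simp add: less_eq_div_iff_mult_less_eq mult.commute)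
  have fin: "finite {r. r \<in> partitions k \<and> R r}" for k
    using finite_partitions by simp
  have inj: "inj_on (\<lambda>(q, r). c q r) ?D" and img: "(\<lambda>(q, r). c q r) ` ?D = {p. 0 \<notin># p}"
    using bij by (auto simp: bij_betw_def)
  have "bij_betw (\<lambda>(j, q, r). c q r) ?S (partitions n)"
    unfolding bij_betw_def
  proof
    show "inj_on (\<lambda>(j, q, r). c q r) ?S"
    proof (rule inj_onI, clarsimp)
      fix j q r j' q' r'
      assume *: "q \<in> partitions j" "r \<in> partitions (n - m * j)" "R r"
        "q' \<in> partitions j'" "r' \<in> partitions (n - m * j')" "R r'" "c q r = c q' r'"
      have "(q, r) = (q', r')"
        by (rule inj_onD [OF inj]) (use * in \<open>auto simp: partitions_def\<close>)
      then show "j = j' \<and> q = q' \<and> r = r'"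
        using * by (auto simp: partitions_def)
    qed
    show "(\<lambda>(j, q, r). c q r) ` ?S = partitions n"
    proof (intro equalityI subsetI)
      fix p assume "p \<in> (\<lambda>(j, q, r). c q r) ` ?S"
      then obtain j q r where *: "j \<le> n div m" "q \<in> partitions j" "r \<in> partitions (n - m * j)"
        "R r" "p = c q r"
        by auto
      have "p \<in> (\<lambda>(q, r). c q r) ` ?D"
        using * by (force simp: partitions_def)
      then have "0 \<notin># p"
        unfolding img by simp
      then show "p \<in> partitions n"
        using * le [of j] by (simp add: partitions_def weight)
    next
      fix p assume p: "p \<in> partitions n"
      then have "p \<in> (\<lambda>(q, r). c q r) ` ?D"
        unfolding img by (simp add: partitions_def)
      then obtain q r where *: "0 \<notin># q" "0 \<notin># r" "R r" "p = c q r"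
        by auto
      then have n: "n = m * \<Sum>\<^sub># q + \<Sum>\<^sub># r"
        using p weight by (simp add: partitions_def)
      then have "(\<Sum>\<^sub># q, q, r) \<in> ?S"
        using * \<open>m > 0\<close> by (auto simp: partitions_def)
      then show "p \<in> (\<lambda>(j, q, r). c q r) ` ?S"
        using * by force
    qed
  qed
  from sum.reindex_bij_betw [OF this, of F]
  have "(\<Sum>p\<in>partitions n. F p) = (\<Sum>(j, q, r)\<in>?S. F (c q r))"
    by (simp add: case_prod_unfold)
  also have "\<dots> = (\<Sum>j\<le>n div m. \<Sum>(q, r)\<in>(SIGMA q:partitions j.
      {r. r \<in> partitions (n - m * j) \<and> R r}). F (c q r))"
    by (subst sum.Sigma) (auto simp: finite_partitions fin)
  also have "\<dots> = (\<Sum>j\<le>n div m. \<Sum>q\<in>partitions j.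
      \<Sum>r | r \<in> partitions (n - m * j) \<and> R r. F (c q r))"
    by (intro sum.cong refl, subst sum.Sigma) (auto simp: finite_partitions fin)
  finally show ?thesis .
qed

lemma bij_betw_parts_divisible:
  fixes m :: nat
  assumes "m > 0"
  shows "bij_betw (\<lambda>(q, r). image_mset ((*) m) q + r)
    ({q. 0 \<notin># q} \<times> {r. 0 \<notin># r \<and> (\<forall>i\<in>#r. \<not> m dvd i)}) {p. 0 \<notin># p}"
proof (rule bij_betw_byWitness [where f' = "\<lambda>p.
    (image_mset (\<lambda>i. i div m) (filter_mset ((dvd) m) p), filter_mset (\<lambda>i. \<not> m dvd i) p)"])
  have "image_mset (\<lambda>i. i div m) (filter_mset ((dvd) m) (image_mset ((*) m) q + r)) = q \<and>
      filter_mset (\<lambda>i. \<not> m dvd i) (image_mset ((*) m) q + r) = r" if "\<forall>i\<in>#r. \<not> m dvd i" for q r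
    using that assms
    by (auto simp: filter_mset_image_mset multiset.map_comp o_def
        filter_mset_eq_conv)
  then show "\<forall>a\<in>{q. 0 \<notin># q} \<times> {r. 0 \<notin># r \<and> (\<forall>i\<in>#r. \<not> m dvd i)}.
    (\<lambda>p. (image_mset (\<lambda>i. i div m) (filter_mset ((dvd) m) p), filter_mset (\<lambda>i. \<not> m dvd i) p))
      ((\<lambda>(q, r). image_mset ((*) m) q + r) a) = a"
    by auto
  have "image_mset ((*) m) (image_mset (\<lambda>i. i div m) (filter_mset ((dvd) m) p)) =
      filter_mset ((dvd) m) p" for p
    unfolding multiset.map_comp o_def by (rule trans [OF image_mset_cong multiset.map_ident]) auto
  then show "\<forall>p\<in>{p. 0 \<notin># p}. (\<lambda>(q, r). image_mset ((*) m) q + r)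
    (image_mset (\<lambda>i. i div m) (filter_mset ((dvd) m) p), filter_mset (\<lambda>i. \<not> m dvd i) p) = p"
    by (auto simp flip: multiset_partition)
qed (use assms in \<open>auto elim!: dvdE\<close>)

text \<open>This is division with remainder by \<open>m\<close>, applied to each multiplicity
  separately: \<open>q\<close> holds the quotients and \<open>r\<close> the remainders.\<close>

lemma bij_betw_multiplicity_blocks:
  fixes m :: nat
  assumes "m > 0"
  shows "bij_betw (\<lambda>(q, r). repeat_mset m q + r)
    ({q. 0 \<notin># q} \<times> {r. 0 \<notin># r \<and> (\<forall>i. count r i < m)}) {p. 0 \<notin># (p :: nat multiset)}"
proof -
  \<comment> \<open>\<open>Abs_multiset\<close> is meaningful only for finitely supported functions;
    \<open>f 0 = 0\<close> keeps the support inside that of \<open>p\<close>.\<close>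
  have count_Abs: "count (Abs_multiset (\<lambda>i. f (count p i))) i = f (count p i)" if "f 0 = 0"
    for f p and i :: nat
  proof -
    have "{i. 0 < f (count p i)} \<subseteq> set_mset p"
      using that by (metis (mono_tags, lifting) less_irrefl mem_Collect_eq not_in_iff subsetI)
    then show ?thesis
      by (simp add: finite_subset)
  qed
  have count_div: "count (Abs_multiset (\<lambda>i. count p i div m)) i = count p i div m"
    and count_mod: "count (Abs_multiset (\<lambda>i. count p i mod m)) i = count p i mod m"
    for p and i :: nat
    using count_Abs [of "\<lambda>c. c div m"] count_Abs [of "\<lambda>c. c mod m"] by simp_all
  show ?thesis
    by (rule bij_betw_byWitness [where f' = "\<lambda>p.
        (Abs_multiset (\<lambda>i. count p i div m), Abs_multiset (\<lambda>i. count p i mod m))"])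
      (use assms in \<open>auto simp: multiset_eq_iff count_div count_mod not_in_iff\<close>)
qed

lemma card_regular_eq_card_bounded:
  assumes "m > 0"
  shows "card {r. r \<in> partitions N \<and> (\<forall>i\<in>#r. \<not> m dvd i)} =
    card {r. r \<in> partitions N \<and> (\<forall>i. count r i < m)}"
proof (induction N rule: less_induct)
  case (less N)
  define A where "A N = card {r. r \<in> partitions N \<and> (\<forall>i\<in>#r. \<not> m dvd i)}" for N
  define B where "B N = card {r. r \<in> partitions N \<and> (\<forall>i. count r i < m)}" for N
  have IH: "A k = B k" if "k < N" for k
    using less that by (simp add: A_def B_def)
  \<comment> \<open>The term \<open>j = 0\<close> has coefficient 1, as only the empty partition has
    size 0; it isolates \<open>A N\<close> and \<open>B N\<close>.\<close>
  have split: "{..N div m} = insert 0 {1..N div m}"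
    by auto
  have zero: "partitions 0 = {{#}}"
    by (auto simp: partitions_def) (metis multiset_nonemptyE)
  \<comment> \<open>Summing the constant 1 counts the partitions of \<open>N\<close>.\<close>
  have "(\<Sum>j\<le>N div m. card (partitions j) * A (N - m * j)) = (\<Sum>p\<in>partitions N. 1)"
    using sum_partitions_decompose [OF assms bij_betw_parts_divisible [OF assms],
        of "\<lambda>_. 1 :: nat" N]
    by (simp add: sum_mset_image_mult A_def)
  also have "\<dots> = (\<Sum>j\<le>N div m. card (partitions j) * B (N - m * j))"
    using sum_partitions_decompose [OF assms bij_betw_multiplicity_blocks [OF assms],
        of "\<lambda>_. 1 :: nat" N]
    by (simp add: sum_mset_repeat_mset B_def)
  finally have "A N + (\<Sum>j=1..N div m. card (partitions j) * A (N - m * j)) =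
      B N + (\<Sum>j=1..N div m. card (partitions j) * B (N - m * j))"
    unfolding split by (simp add: zero)
  moreover have "(\<Sum>j=1..N div m. card (partitions j) * A (N - m * j)) =
      (\<Sum>j=1..N div m. card (partitions j) * B (N - m * j))"
  proof (rule sum.cong [OF refl])
    fix j assume "j \<in> {1..N div m}"
    \<comment> \<open>Truncated subtraction is strict only for positive \<open>N\<close>; for
      \<open>N = 0\<close> the range of \<open>j\<close> is empty.\<close>
    then have "N - m * j < N"
      using assms by (cases "N = 0") auto
    then show "card (partitions j) * A (N - m * j) = card (partitions j) * B (N - m * j)"
      by (simp add: IH)
  qed
  ultimately show ?case
    by (simp add: A_def B_def)
qed

lemma alpha_combine:
  assumes "m > 0" "\<forall>i\<in>#r. \<not> m dvd i"
  shows "alpha k m (image_mset ((*) m) q + r) = count q k"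
proof -
  have "count r (k * m) = 0"
    using assms(2) by (auto simp flip: not_in_iff)
  moreover have "count (image_mset ((*) m) q) (k * m) = count q k"
    using assms(1) by (induction q) auto
  ultimately show ?thesis
    by (simp add: alpha_def)
qed

lemma gamma_combine:
  assumes "\<forall>i\<in>#r. \<not> m dvd i"
  shows "gamma m (image_mset ((*) m) q + r) = \<Sum>\<^sub># r"
proof -
  have "count (image_mset ((*) m) q) i = 0" if "\<not> m dvd i" for i
    using that by (auto simp flip: not_in_iff)
  then show ?thesis
    unfolding gamma_def sum_mset_eq_sum_count [OF finite_set_mset order_refl]
    using assms by (intro sum.cong) auto
qed

lemma alpha'_combine:
  assumes "\<forall>i. count r i < m"
  shows "alpha' k m (repeat_mset m q + r) = count q k"
  using spec [OF assms, of k] by (simp add: alpha'_def)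

text \<open>The blocks vanish modulo \<open>m\<close>, and the multiplicities in \<open>r\<close>
  are already reduced. The bound \<open>N \<le> n\<close> is there because \<open>gamma'\<close>
  sees only parts up to \<open>n\<close>.\<close>

lemma gamma'_combine:
  assumes "\<forall>i. count r i < m" "r \<in> partitions N" "N \<le> n"
  shows "gamma' n m (repeat_mset m q + r) = \<Sum>\<^sub># r"
proof -
  have "i \<in> {1..n}" if "i \<in># r" for i
    using assms that sum_mset.remove [OF that] by (cases i) (auto simp: partitions_def)
  then have "\<Sum>\<^sub># r = (\<Sum>i=1..n. i * count r i)"
    by (intro sum_mset_eq_sum_count) auto
  then show ?thesis
    using assms(1) by (simp add: gamma'_def)
qed

theorem theorem2p1:
  fixes m n :: nat
  assumes "m > 0" and "n > 0"
  shows "(\<Sum>p\<in>partitions n. (\<Prod>k=1..n. var (X k) ^ alpha k m p) * var Z ^ gamma m p)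
       = (\<Sum>p\<in>partitions n. (\<Prod>k=1..n. var (X k) ^ alpha' k m p) * var Z ^ gamma' n m p)"
proof -
  \<comment> \<open>The common monomial of both sides; it depends on \<open>r\<close> only through
    the size \<open>N\<close>.\<close>
  define G where "G q N = (\<Prod>k=1..n. var (X k) ^ count q k) * var Z ^ N" for q N
  have "(\<Sum>p\<in>partitions n. (\<Prod>k=1..n. var (X k) ^ alpha k m p) * var Z ^ gamma m p) =
      (\<Sum>j\<le>n div m. \<Sum>q\<in>partitions j.
        \<Sum>r | r \<in> partitions (n - m * j) \<and> (\<forall>i\<in>#r. \<not> m dvd i). G q (n - m * j))"
    by (subst sum_partitions_decompose [OF assms(1) bij_betw_parts_divisible [OF assms(1)]],
        simp add: sum_mset_image_mult, intro sum.cong refl) (auto simp: G_def alpha_combine gamma_combine assms partitions_def)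
  \<comment> \<open>The innermost summand is constant in \<open>r\<close>, so only the number of
    remainders matters.\<close>
  also have "\<dots> = (\<Sum>j\<le>n div m. \<Sum>q\<in>partitions j.
        \<Sum>r | r \<in> partitions (n - m * j) \<and> (\<forall>i. count r i < m). G q (n - m * j))"
    by (simp add: card_regular_eq_card_bounded [OF assms(1)])
  also have "\<dots> =
      (\<Sum>p\<in>partitions n. (\<Prod>k=1..n. var (X k) ^ alpha' k m p) * var Z ^ gamma' n m p)"
    by (subst sum_partitions_decompose [OF assms(1) bij_betw_multiplicity_blocks [OF assms(1)]],
        simp add: sum_mset_repeat_mset, intro sum.cong refl)
      (auto simp: G_def alpha'_combine gamma'_combine [where N = "n - m * j" for j] partitions_def)
  finally show ?thesis .
qed

end
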